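(* Let $G=(V,E)$ be a finite simple undirected graph and let $a,b\in V$ be twins, i.e. $\Gamma(a)=\Gamma(b)$. Then there exists a node ordering $\sigma'=x_1\cdots x_i\,a\,b\,x_{i+1}\cdots x_l$ of $G$, with $x_j\in V\setminus\{a,b\}$ (so $b$ is eliminated immediately after $a$), such that $\phi(G,\sigma')=\Phi(G)$.
   Context: $\Gamma(v)$ is the (open) neighborhood of $v$ in $G$. The deficiency of $v$ in $G$ is $D_G(v)=\{\{c,d\}: c,d\in\Gamma_G(v),\ c\neq d,\ \{c,d\}\notin E\}$. Eliminating $v$ from $G$ gives $G_v=(V\setminus\{v\},\,E(V\setminus\{v\})\cup D_G(v))$, where $E(U)$ denotes the edges with both endpoints in $U$. A node ordering of $G$ with $n=|V|$ is a bijection $\sigma:\{1,\dots,n\}\to V$, written $x_1x_2\cdots x_n$ with $\sigma(j)=x_j$; it defines $G^{(0)}=G$ and $G^{(i)}=(G^{(i-1)})_{\sigma(i)}$. Its fill-in is $\phi(G,\sigma)=\sum_{i=1}^n |D_{G^{(i-1)}}(\sigma(i))|$, and $\Phi(G)=\min_\sigma\phi(G,\sigma)$. *)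

theory Defs imports Main begin

type_synonym 'a graph = "'a set \<times> 'a set set"

definition finite_simple_graph :: "'a graph \<Rightarrow> bool" where
  "finite_simple_graph G \<longleftrightarrow> finite (fst G) \<and> (\<forall>e \<in> snd G. e \<subseteq> fst G \<and> card e = 2)"

definition neighborhood :: "'a graph \<Rightarrow> 'a \<Rightarrow> 'a set" where
  "neighborhood G v = {w \<in> fst G. {v, w} \<in> snd G}"

definition deficiency :: "'a graph \<Rightarrow> 'a \<Rightarrow> 'a set set" where
  "deficiency G v =
     {{c, d} | c d. c \<in> neighborhood G v \<and> d \<in> neighborhood G v \<and> c \<noteq> d \<and> {c, d} \<notin> snd G}"

definition edges_within :: "'a graph \<Rightarrow> 'a set \<Rightarrow> 'a set set" where
  "edges_within G U = {e \<in> snd G. e \<subseteq> U}"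

definition eliminate :: "'a graph \<Rightarrow> 'a \<Rightarrow> 'a graph" where
  "eliminate G v = (fst G - {v}, edges_within G (fst G - {v}) \<union> deficiency G v)"

text \<open>Only the values of an ordering on \<open>{1..card (fst G)}\<close> are relevant; the values elsewhere are junk.\<close>

definition node_ordering :: "'a graph \<Rightarrow> (nat \<Rightarrow> 'a) \<Rightarrow> bool" where
  "node_ordering G \<sigma> \<longleftrightarrow> bij_betw \<sigma> {1..card (fst G)} (fst G)"

primrec elim_graph :: "'a graph \<Rightarrow> (nat \<Rightarrow> 'a) \<Rightarrow> nat \<Rightarrow> 'a graph" where
  "elim_graph G \<sigma> 0 = G"
| "elim_graph G \<sigma> (Suc i) = eliminate (elim_graph G \<sigma> i) (\<sigma> (Suc i))"

definition fill_in :: "'a graph \<Rightarrow> (nat \<Rightarrow> 'a) \<Rightarrow> nat" where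
  "fill_in G \<sigma> = (\<Sum>i = 1..card (fst G). card (deficiency (elim_graph G \<sigma> (i - 1)) (\<sigma> i)))"

definition min_fill_in :: "'a graph \<Rightarrow> nat" where
  "min_fill_in G = (LEAST k. \<exists>\<sigma>. node_ordering G \<sigma> \<and> fill_in G \<sigma> = k)"

definition twins :: "'a graph \<Rightarrow> 'a \<Rightarrow> 'a \<Rightarrow> bool" where
  "twins G a b \<longleftrightarrow> neighborhood G a = neighborhood G b"

end

theory Submission imports Defs begin

text \<open>
  Adding to \<open>G\<close> the fill edges of an ordering gives a supergraph for which the ordering is a perfect
  elimination ordering, and every supergraph with a perfect elimination ordering \<open>\<sigma>\<close> contains the
  fill edges of \<open>\<sigma>\<close>.  So it suffices to modify an optimal supergraph \<open>H\<close> together with its ordering,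
  without increasing the number of edges.

  If the common neighbourhood \<open>N\<close> of the twins is a clique of \<open>H\<close>, shrink the neighbourhoods of
  \<open>a\<close> and \<open>b\<close> to \<open>N\<close> and eliminate them first.  Otherwise \<open>a\<close>, \<open>b\<close> and two nonadjacent members of
  \<open>N\<close> form a 4-cycle, so \<open>a\<close> and \<open>b\<close> are adjacent in \<open>H\<close>; replace the one of larger degree by a copy
  of the other and put the copy next to the original in the ordering.

  Orderings of \<open>H\<close> are represented by injective ranks, since inserting a vertex next to another
  one is then just arithmetic.
\<close>

section \<open>Perfect elimination rankings and simple edge sets\<close>

text \<open>\<open>r\<close> encodes a perfect elimination ordering of \<open>(V, H)\<close>. Only
  the relative order of the ranks matters and gaps are allowed.\<close>

definition perfect_ranking :: "'a set \<Rightarrow> 'a set set \<Rightarrow> ('a \<Rightarrow> nat) \<Rightarrow> bool" where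
  "perfect_ranking V H r \<longleftrightarrow> inj_on r V \<and>
     (\<forall>v\<in>V. \<forall>x\<in>V. \<forall>y\<in>V. r v < r x \<longrightarrow> r v < r y \<longrightarrow> x \<noteq> y \<longrightarrow>
        {v, x} \<in> H \<longrightarrow> {v, y} \<in> H \<longrightarrow> {x, y} \<in> H)"

definition simple_edges :: "'a set \<Rightarrow> 'a set set \<Rightarrow> bool" where
  "simple_edges V H \<longleftrightarrow> (\<forall>e\<in>H. e \<subseteq> V \<and> card e = 2)"

lemma perfect_rankingD:
  assumes "perfect_ranking V H r" "v \<in> V" "x \<in> V" "y \<in> V" "r v < r x" "r v < r y" "x \<noteq> y"
    "{v, x} \<in> H" "{v, y} \<in> H"
  shows "{x, y} \<in> H"
  using assms unfolding perfect_ranking_def by blast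

lemma simple_edgesD:
  assumes "simple_edges V H" "{x, y} \<in> H"
  shows "x \<in> V" "y \<in> V" "x \<noteq> y"
proof -
  have "{x, y} \<subseteq> V" "card {x, y} = 2"
    using assms unfolding simple_edges_def by blast+
  then show "x \<in> V" "y \<in> V" "x \<noteq> y" by auto
qed

lemma simple_edgesE:
  assumes "simple_edges V H" "e \<in> H"
  obtains x y where "e = {x, y}" "x \<noteq> y" "x \<in> V" "y \<in> V"
proof -
  have "e \<subseteq> V" "card e = 2"
    using assms unfolding simple_edges_def by blast+
  then show thesis using that by (auto simp: card_2_iff)
qed

lemma finite_simple_edges: "simple_edges V H \<Longrightarrow> finite V \<Longrightarrow> finite H"
  by (rule finite_subset[of _ "Pow V"]) (auto simp: simple_edges_def)

subsection \<open>The filled graph of an ordering\<close>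

text \<open>The cut-off \<open>k\<close> permits induction along the elimination;
  \<open>k = card (fst G)\<close> gives the full filled graph.\<close>

definition filled :: "'a graph \<Rightarrow> (nat \<Rightarrow> 'a) \<Rightarrow> nat \<Rightarrow> 'a set set" where
  "filled G \<sigma> k = snd G \<union> (\<Union>i<k. deficiency (elim_graph G \<sigma> i) (\<sigma> (Suc i)))"

lemma filled_0 [simp]: "filled G \<sigma> 0 = snd G"
  by (simp add: filled_def)

lemma filled_Suc:
  "filled G \<sigma> (Suc k) = filled G \<sigma> k \<union> deficiency (elim_graph G \<sigma> k) (\<sigma> (Suc k))"
  by (auto simp: filled_def less_Suc_eq)

lemma filled_mono: "k \<le> m \<Longrightarrow> filled G \<sigma> k \<subseteq> filled G \<sigma> m"
  unfolding filled_def by (intro Un_mono UN_mono) auto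

lemma fst_elim_graph: "fst (elim_graph G \<sigma> k) = fst G - \<sigma> ` {1..k}"
  by (induction k) (auto simp: eliminate_def atLeastAtMostSuc_conv)

lemma deficiency_subset:
  assumes "e \<in> deficiency G v"
  shows "e \<subseteq> fst G" "e \<notin> snd G" "card e = 2"
  using assms by (auto simp: deficiency_def neighborhood_def)

text \<open>Elimination keeps every edge between surviving vertices. Both conjuncts go through one
  induction because the step needs simplicity to exclude a loop at the eliminated vertex.\<close>

lemma snd_elim_graph:
  assumes "simple_edges (fst G) (snd G)"
  shows "snd (elim_graph G \<sigma> k) = {e \<in> filled G \<sigma> k. e \<subseteq> fst (elim_graph G \<sigma> k)}
    \<and> simple_edges (fst G) (filled G \<sigma> k)"
proof (induction k)
  case 0
  then show ?case using assms by (auto simp: simple_edges_def)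
next
  case (Suc k)
  let ?K = "elim_graph G \<sigma> k" and ?v = "\<sigma> (Suc k)"
  have fst_le: "fst ?K \<subseteq> fst G"
    by (auto simp: fst_elim_graph)
  have simple: "simple_edges (fst G) (filled G \<sigma> (Suc k))"
    unfolding simple_edges_def filled_Suc
  proof
    fix e assume "e \<in> filled G \<sigma> k \<union> deficiency ?K ?v"
    then show "e \<subseteq> fst G \<and> card e = 2"
      using Suc fst_le deficiency_subset(1,3)[of e ?K ?v] unfolding simple_edges_def by blast
  qed
  have "{?v, ?v} \<notin> snd ?K"
    using Suc by (auto simp: simple_edges_def)
  then have "e \<subseteq> fst ?K - {?v}" if "e \<in> deficiency ?K ?v" for e
    using that by (auto simp: deficiency_def neighborhood_def)
  then have "snd (eliminate ?K ?v) = {e \<in> filled G \<sigma> (Suc k). e \<subseteq> fst (eliminate ?K ?v)}"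
    using Suc by (auto simp: eliminate_def edges_within_def filled_Suc)
  then show ?case using simple by simp
qed

text \<open>The fill edges of a step join surviving vertices but are missing from the current graph,
  so they are new to the filled graph as well and the union is disjoint.\<close>

lemma card_filled:
  assumes "simple_edges (fst G) (snd G)" "finite (fst G)"
  shows "card (filled G \<sigma> k) =
    card (snd G) + (\<Sum>i = 1..k. card (deficiency (elim_graph G \<sigma> (i - 1)) (\<sigma> i)))"
proof (induction k)
  case 0
  then show ?case by simp
next
  case (Suc k)
  let ?D = "deficiency (elim_graph G \<sigma> k) (\<sigma> (Suc k))"
  have "finite (filled G \<sigma> (Suc k))"
    using snd_elim_graph[OF assms(1)] finite_simple_edges assms(2) by blast
  then have "finite (filled G \<sigma> k)" "finite ?D"
    by (auto simp: filled_Suc)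
  moreover have "filled G \<sigma> k \<inter> ?D = {}"
    using snd_elim_graph[OF assms(1), of \<sigma> k] deficiency_subset[of _ "elim_graph G \<sigma> k" "\<sigma> (Suc k)"]
    by blast
  ultimately show ?case
    using Suc by (simp add: filled_Suc card_Un_disjoint)
qed

text \<open>As \<open>card (snd G)\<close> is fixed, minimising the fill-in means minimising the
  number of edges of the filled graph.\<close>

lemma card_filled_fill_in:
  assumes "simple_edges (fst G) (snd G)" "finite (fst G)"
  shows "card (filled G \<sigma> (card (fst G))) = card (snd G) + fill_in G \<sigma>"
  using card_filled[OF assms] by (simp add: fill_in_def)

text \<open>By induction the current graph lies in \<open>H\<close>. The vertex eliminated next has
  the least rank among the survivors, so its neighbours are later neighbours in \<open>H\<close> and
  already form a clique there.\<close>

lemma filled_subset_perfect: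
  assumes simple: "simple_edges (fst G) (snd G)"
    and perfect: "perfect_ranking (fst G) H r" and "snd G \<subseteq> H"
    and \<sigma>: "\<sigma> ` {1..n} = fst G" and mono: "strict_mono_on {1..n} (r \<circ> \<sigma>)"
  shows "k \<le> n \<Longrightarrow> filled G \<sigma> k \<subseteq> H"
proof (induction k)
  case 0
  then show ?case using assms by simp
next
  case (Suc k)
  let ?K = "elim_graph G \<sigma> k" and ?v = "\<sigma> (Suc k)"
  have v: "?v \<in> fst G" using \<sigma> Suc.prems by auto
  have later: "r ?v < r x" if "x \<in> fst ?K" "x \<noteq> ?v" for x
  proof -
    have "x \<in> \<sigma> ` {1..n}" "x \<notin> \<sigma> ` {1..k}"
      using that(1) \<sigma> by (simp_all add: fst_elim_graph)
    then obtain j where j: "j \<in> {1..n}" "x = \<sigma> j" "j \<notin> {1..k}"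
      by blast
    then have "Suc k < j" using that by (cases "j = Suc k") auto
    then show ?thesis using mono j Suc.prems by (auto simp: strict_mono_on_def)
  qed
  have E: "snd ?K \<subseteq> H" "simple_edges (fst G) (snd ?K)"
    using snd_elim_graph[OF simple, of \<sigma> k] Suc by (auto simp: simple_edges_def)
  have "deficiency ?K ?v \<subseteq> H"
  proof
    fix e assume "e \<in> deficiency ?K ?v"
    then obtain c d where cd: "e = {c, d}" "c \<noteq> d" "c \<in> fst ?K" "d \<in> fst ?K"
      "{?v, c} \<in> snd ?K" "{?v, d} \<in> snd ?K"
      by (auto simp: deficiency_def neighborhood_def)
    then have "r ?v < r c" "r ?v < r d" "c \<in> fst G" "d \<in> fst G"
      using later simple_edgesD[OF E(2)] by metis+
    then show "e \<in> H"
      using perfect_rankingD[OF perfect v, of c d] cd E(1) by blast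
  qed
  then show ?case using Suc by (simp add: filled_Suc)
qed

text \<open>The rank of a vertex is its position in \<open>\<sigma>\<close>. Two later neighbours of
  \<open>v\<close> are already its neighbours when \<open>v\<close> is eliminated, so they are
  adjacent then or become so by the fill.\<close>

lemma perfect_ranking_filled:
  assumes simple: "simple_edges (fst G) (snd G)" and bij: "bij_betw \<sigma> {1..n} (fst G)"
  shows "perfect_ranking (fst G) (filled G \<sigma> n) (inv_into {1..n} \<sigma>)"
  unfolding perfect_ranking_def
proof (intro conjI ballI impI)
  show "inj_on (inv_into {1..n} \<sigma>) (fst G)"
    using bij by (metis bij_betw_imp_surj_on inj_on_inv_into order_refl)
next
  let ?r = "inv_into {1..n} \<sigma>"
  fix v x y
  assume V: "v \<in> fst G" "x \<in> fst G" "y \<in> fst G" and less: "?r v < ?r x" "?r v < ?r y" and "x \<noteq> y"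
    and edges: "{v, x} \<in> filled G \<sigma> n" "{v, y} \<in> filled G \<sigma> n"
  have inv: "?r z \<in> {1..n}" "\<sigma> (?r z) = z" if "z \<in> fst G" for z
    using that bij by (metis bij_betw_imp_surj_on inv_into_into, metis bij_betw_inv_into_right)
  \<comment> \<open>Positions start at 1, so stage \<open>k\<close> is the graph just before
    \<open>v\<close> is eliminated.\<close>
  obtain k where k: "?r v = Suc k" using inv[OF V(1)] by (cases "?r v") auto
  let ?K = "elim_graph G \<sigma> k"
  have alive: "z \<in> fst ?K" if "z \<in> fst G" "Suc k \<le> ?r z" for z
  proof -
    have "?r (\<sigma> j) = j" if "j \<in> {1..k}" for j
      using that k inv[OF V(1)] bij by (intro bij_betw_inv_into_left) auto
    then have "z \<notin> \<sigma> ` {1..k}" using that by force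
    then show ?thesis using that by (simp add: fst_elim_graph)
  qed
  have v: "\<sigma> (Suc k) = v" using inv[OF V(1)] k by simp
  \<comment> \<open>From stage \<open>k\<close> on no fill edge meets \<open>v\<close>: its own
    deficiency avoids it, and afterwards it is gone.\<close>
  have old: "e \<in> filled G \<sigma> m \<Longrightarrow> v \<in> e \<Longrightarrow> e \<in> filled G \<sigma> k" if "k \<le> m" for m e
    using that
  proof (induction m rule: dec_induct)
    case base
    then show ?case by simp
  next
    case (step m)
    let ?M = "elim_graph G \<sigma> m"
    have "v \<notin> e" if e: "e \<in> deficiency ?M (\<sigma> (Suc m))"
    proof (cases "m = k")
      case True
      have "{v, v} \<notin> snd ?M"
        using snd_elim_graph[OF simple, of \<sigma> m] by (auto simp: simple_edges_def)
      then show ?thesis using e True v by (auto simp: deficiency_def neighborhood_def)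
    next
      case False
      then have "v \<in> \<sigma> ` {1..m}" using step v by (intro image_eqI[of _ _ "Suc k"]) auto
      then show ?thesis using deficiency_subset(1)[OF e] by (auto simp: fst_elim_graph)
    qed
    then show ?case using step by (auto simp: filled_Suc)
  qed
  have "Suc k \<le> n" using inv[OF V(1)] k by simp
  then have "{v, x} \<in> snd ?K" "{v, y} \<in> snd ?K"
    using old[of n] edges alive V less k snd_elim_graph[OF simple, of \<sigma> k] by auto
  moreover have "x \<in> fst ?K" "y \<in> fst ?K"
    using alive V less k by auto
  ultimately have "{x, y} \<in> snd ?K \<union> deficiency ?K v"
    using \<open>x \<noteq> y\<close> by (auto simp: deficiency_def neighborhood_def)
  then have "{x, y} \<in> filled G \<sigma> (Suc k)"
    using snd_elim_graph[OF simple, of \<sigma> k] v by (auto simp: filled_Suc)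
  then show "{x, y} \<in> filled G \<sigma> n"
    using filled_mono[OF \<open>Suc k \<le> n\<close>] by blast
qed

lemma ex_ordering_of_ranking:
  fixes r :: "'a \<Rightarrow> nat"
  assumes "finite V" "inj_on r V"
  obtains \<sigma> where "bij_betw \<sigma> {1..card V} V" "strict_mono_on {1..card V} (r \<circ> \<sigma>)"
proof -
  let ?xs = "sorted_list_of_set (r ` V)"
  \<comment> \<open>Position \<open>i\<close> gets the vertex of \<open>i\<close>-th smallest rank;
    lists are indexed from 0.\<close>
  define \<sigma> where "\<sigma> i = inv_into V r (?xs ! (i - 1))" for i
  have len: "length ?xs = card V" using assms by (simp add: card_image)
  have nth: "?xs ! (i - 1) \<in> r ` V" if "i \<in> {1..card V}" for i
    using nth_mem[of "i - 1" ?xs] that len assms by auto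
  have r\<sigma>: "r (\<sigma> i) = ?xs ! (i - 1)" and V: "\<sigma> i \<in> V" if "i \<in> {1..card V}" for i
    using nth[OF that] by (auto simp: \<sigma>_def f_inv_into_f intro: inv_into_into)
  have mono: "strict_mono_on {1..card V} (r \<circ> \<sigma>)"
    using strict_sorted_list_of_set[of "r ` V"] len
    by (auto simp: strict_mono_on_def r\<sigma> sorted_wrt_iff_nth_less)
  then have inj: "inj_on \<sigma> {1..card V}"
    using strict_mono_on_imp_inj_on inj_on_imageI2 by blast
  have "\<sigma> ` {1..card V} = V"
    using V assms(1) inj by (intro card_subset_eq) (auto simp: card_image)
  then show thesis
    using that mono inj by (auto simp: bij_betw_def)
qed

subsection \<open>Making the twins consecutive\<close>

text \<open>Moved to the front, \<open>a\<close> and \<open>b\<close> have only the clique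
  \<open>N\<close> as neighbours. For any other vertex, neither twin is later, so its condition is
  inherited from \<open>H\<close>.\<close>

lemma shrink_twins:
  assumes perfect: "perfect_ranking V H r"
    and N: "N \<subseteq> V - {a, b}" "\<And>x. x \<in> N \<Longrightarrow> {a, x} \<in> H \<and> {b, x} \<in> H"
    and clique: "\<And>c d. c \<in> N \<Longrightarrow> d \<in> N \<Longrightarrow> c \<noteq> d \<Longrightarrow> {c, d} \<in> H"
  defines "H' \<equiv> {e \<in> H. a \<notin> e \<and> b \<notin> e} \<union> (\<lambda>x. {a, x}) ` N \<union> (\<lambda>x. {b, x}) ` N"
    and "r' \<equiv> \<lambda>v. if v = a then 0 else if v = b then 1 else r v + 2"
  shows "H' \<subseteq> H" "perfect_ranking V H' r'"
proof -
  show "H' \<subseteq> H" using N by (auto simp: H'_def)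
  have H': "{u, v} \<in> H' \<longleftrightarrow>
      (if u \<in> {a, b} then v \<in> N else if v \<in> {a, b} then u \<in> N else {u, v} \<in> H)" for u v
    using N(1) by (auto simp: H'_def doubleton_eq_iff)
  show "perfect_ranking V H' r'"
    unfolding perfect_ranking_def
  proof (intro conjI ballI impI)
    show "inj_on r' V"
      using perfect by (auto simp: perfect_ranking_def r'_def inj_on_def)
  next
    fix v x y
    assume *: "v \<in> V" "x \<in> V" "y \<in> V" "r' v < r' x" "r' v < r' y" "x \<noteq> y"
      "{v, x} \<in> H'" "{v, y} \<in> H'"
    show "{x, y} \<in> H'"
    proof (cases "v \<in> {a, b}")
      case True
      then have "x \<in> N" "y \<in> N" using * H' by (auto split: if_splits)
      then show ?thesis using N(1) clique * unfolding H' by auto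
    next
      case False
      then have "x \<notin> {a, b}" "y \<notin> {a, b}" "r v < r x" "r v < r y"
        using *(4,5) by (auto simp: r'_def split: if_splits)
      then show ?thesis
        using False * perfect_rankingD[OF perfect, of v x y] unfolding H' by auto
    qed
  qed
qed

text \<open>The offsets \<open>s\<close> and \<open>t\<close> decide which of \<open>x\<close> and its copy \<open>y\<close> comes first: whichever twin
  is kept, \<open>a\<close> has to precede \<open>b\<close>.\<close>

lemma copy_vertex:
  assumes simple: "simple_edges V H" and "finite V" and perfect: "perfect_ranking V H r"
    and xy: "x \<in> V" "y \<in> V" "x \<noteq> y" "{x, y} \<in> H"
    and deg: "card {z. {x, z} \<in> H} \<le> card {z. {y, z} \<in> H}"
    and st: "s \<le> 1" "t \<le> 1" "s \<noteq> t"
  defines "H' \<equiv> {e \<in> H. y \<notin> e} \<union> insert {x, y} ((\<lambda>z. {y, z}) ` ({z. {x, z} \<in> H} - {y}))"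
    and "r' \<equiv> \<lambda>v. if v = x then 2 * r x + s else if v = y then 2 * r x + t else 2 * r v"
  shows "card H' \<le> card H" "perfect_ranking V H' r'"
proof -
  define X where "X = {z. {x, z} \<in> H} - {y}"
  define Y where "Y = {z. {y, z} \<in> H} - {x}"
  let ?R = "{e \<in> H. y \<notin> e}"
  have fin: "finite H" using finite_simple_edges assms by blast
  have sub: "{z. {x, z} \<in> H} \<subseteq> V" "{z. {y, z} \<in> H} \<subseteq> V"
    using simple_edgesD[OF simple] by blast+
  then have finX: "finite {z. {x, z} \<in> H}" "finite {z. {y, z} \<in> H}"
    using \<open>finite V\<close> finite_subset by blast+
  have "card X = card {z. {x, z} \<in> H} - 1" "card Y = card {z. {y, z} \<in> H} - 1"
    using xy by (auto simp: X_def Y_def insert_commute)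
  then have XY: "card X \<le> card Y" using deg by simp
  \<comment> \<open>\<open>H\<close> and \<open>H'\<close> agree away from \<open>y\<close>. At
    \<open>y\<close>, both have the edge to \<open>x\<close>, and the others are indexed by
    \<open>Y\<close> in \<open>H\<close> and by \<open>X\<close> in \<open>H'\<close>.\<close>
  have "card H' \<le> card ?R + card (insert {x, y} ((\<lambda>z. {y, z}) ` X))"
    unfolding H'_def X_def by (rule card_Un_le)
  also have "\<dots> \<le> card ?R + Suc (card X)"
    using card_image_le[of X "\<lambda>z. {y, z}"] finX
    by (auto simp: card_insert_if X_def)
  also have "\<dots> \<le> card ?R + Suc (card Y)" using XY by simp
  also have "Suc (card Y) = card (insert {x, y} ((\<lambda>z. {y, z}) ` Y))"
  proof -
    have "inj_on (\<lambda>z. {y, z}) Y" by (auto simp: inj_on_def doubleton_eq_iff)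
    moreover have "{x, y} \<notin> (\<lambda>z. {y, z}) ` Y" by (auto simp: Y_def doubleton_eq_iff)
    moreover have "finite Y" using finX by (simp add: Y_def)
    ultimately show ?thesis by (simp add: card_image)
  qed
  also have "card ?R + \<dots> = card (?R \<union> insert {x, y} ((\<lambda>z. {y, z}) ` Y))"
    using fin finX by (intro card_Un_disjoint[symmetric]) (auto simp: Y_def)
  also have "\<dots> \<le> card H"
    using fin xy by (intro card_mono) (auto simp: Y_def)
  finally show "card H' \<le> card H" .

  \<comment> \<open>\<open>p\<close> folds the copy \<open>y\<close> onto \<open>x\<close>. Then
    \<open>H'\<close> is the pullback of \<open>H\<close> along \<open>p\<close> with the pair
    \<open>x\<close>, \<open>y\<close> joined, so perfection transfers from
    \<open>H\<close>.\<close>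
  define p where "p v = (if v = y then x else v)" for v
  have pV: "p v \<in> V" if "v \<in> V" for v using that xy by (simp add: p_def)
  have H': "{u, v} \<in> H' \<longleftrightarrow> u \<noteq> v \<and> (p u = p v \<or> {p u, p v} \<in> H)" for u v
    using xy simple_edgesD[OF simple]
    by (auto simp: H'_def p_def doubleton_eq_iff insert_commute)
  have inj: "r u = r v \<longleftrightarrow> u = v" if "u \<in> V" "v \<in> V" for u v
    using perfect that by (auto simp: perfect_ranking_def inj_on_def)
  \<comment> \<open>Doubling the ranks leaves room for the offsets, so \<open>p\<close> preserves
    the order weakly.\<close>
  have le: "r (p u) \<le> r (p v)" if "r' u < r' v" for u v
    using that st by (auto simp: r'_def p_def split: if_splits)
  show "perfect_ranking V H' r'"
    unfolding perfect_ranking_def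
  proof (intro conjI ballI impI)
    have "u = v" if "u \<in> V" "v \<in> V" "r' u = r' v" for u v
    proof -
      have "r (p u) = r (p v)"
        using that(3) st by (auto simp: r'_def p_def split: if_splits)
      then have "p u = p v" using inj pV that by blast
      then show ?thesis using that(3) st xy by (auto simp: r'_def p_def split: if_splits)
    qed
    then show "inj_on r' V" by (auto simp: inj_on_def)
  next
    fix v u w
    assume *: "v \<in> V" "u \<in> V" "w \<in> V" "r' v < r' u" "r' v < r' w" "u \<noteq> w"
      "{v, u} \<in> H'" "{v, w} \<in> H'"
    have "p u = p w \<or> {p u, p w} \<in> H"
    \<comment> \<open>If \<open>p\<close> identifies \<open>v\<close> with \<open>u\<close> or
      \<open>w\<close>, the given edges at \<open>v\<close> already yield the claim.\<close>
    proof (cases "p u = p w \<or> p v = p u \<or> p v = p w")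
      case True
      then show ?thesis using *(7,8) unfolding H' by (auto simp: insert_commute)
    next
      case False
      then have "r (p v) < r (p u)" "r (p v) < r (p w)"
        using le *(1-5) inj pV by (metis le_neq_implies_less)+
      then show ?thesis
        using perfect_rankingD[OF perfect, of "p v" "p u" "p w"] False * pV unfolding H' by blast
    qed
    then show "{u, w} \<in> H'" using *(6) unfolding H' by blast
  qed
qed

text \<open>\<open>E\<close> stands for the original edges and \<open>H\<close> for an optimal
  filled graph. Consecutive ranks leave no room for a vertex between \<open>a\<close> and
  \<open>b\<close>.\<close>

lemma ex_perfect_consecutive:
  assumes simple: "simple_edges V H" and "finite V" and perfect: "perfect_ranking V H r"
    and ab: "a \<in> V" "b \<in> V" "a \<noteq> b"
    and E: "E \<subseteq> H" and twin: "\<And>x. {a, x} \<in> E \<longleftrightarrow> {b, x} \<in> E"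
  shows "\<exists>H' r'. E \<subseteq> H' \<and> finite H' \<and> card H' \<le> card H \<and> perfect_ranking V H' r' \<and>
    r' b = Suc (r' a)"
proof -
  define N where "N = {x. {a, x} \<in> E}"
  \<comment> \<open>An edge between twins would force a loop at \<open>b\<close>.\<close>
  have nab: "{a, b} \<notin> E"
    using twin[of b] E simple_edgesD(3)[OF simple, of b b] by blast
  have N: "N \<subseteq> V - {a, b}" "\<And>x. x \<in> N \<Longrightarrow> {a, x} \<in> E \<and> {b, x} \<in> E"
    using nab twin E simple_edgesD(2)[OF simple, of a] simple_edgesD(3)[OF simple, of a a]
    unfolding N_def by blast+
  have finH: "finite H" using finite_simple_edges assms by blast
  have E_cases: "(a \<notin> e \<and> b \<notin> e) \<or> (\<exists>x\<in>N. e = {a, x}) \<or> (\<exists>x\<in>N. e = {b, x})"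
    if e: "e \<in> E" for e
  proof -
    obtain u v where uv: "e = {u, v}"
      using e E simple simple_edgesE by (metis subsetD)
    then have vu: "e = {v, u}" by (simp add: insert_commute)
    have "v \<in> N" if "u \<in> {a, b}" using that e uv twin[of v] by (auto simp: N_def)
    moreover have "u \<in> N" if "v \<in> {a, b}" using that e vu twin[of u] by (auto simp: N_def)
    ultimately show ?thesis using uv vu by blast
  qed
  show ?thesis
  proof (cases "\<forall>c\<in>N. \<forall>d\<in>N. c \<noteq> d \<longrightarrow> {c, d} \<in> H")
    case True
    note shrink = shrink_twins[OF perfect N(1)]
    let ?H' = "{e \<in> H. a \<notin> e \<and> b \<notin> e} \<union> (\<lambda>x. {a, x}) ` N \<union> (\<lambda>x. {b, x}) ` N"
    let ?r' = "\<lambda>v. if v = a then 0 else if v = b then 1 else r v + 2"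
    have "?H' \<subseteq> H" "perfect_ranking V ?H' ?r'"
      using shrink True N(2) E by blast+
    moreover have "E \<subseteq> ?H'"
      using E_cases E by blast
    moreover have "?r' b = Suc (?r' a)"
      using ab(3) by simp
    moreover have "finite ?H'" "card ?H' \<le> card H"
      using finite_subset[OF \<open>?H' \<subseteq> H\<close> finH] card_mono[OF finH \<open>?H' \<subseteq> H\<close>] .
    ultimately show ?thesis
      by (intro exI[of _ ?H'] exI[of _ ?r'] conjI)
  next
    case False
    then obtain c d where cd: "c \<in> N" "d \<in> N" "c \<noteq> d" "{c, d} \<notin> H" by blast
    have V: "c \<in> V" "d \<in> V" "c \<noteq> a" "c \<noteq> b" "d \<noteq> a" "d \<noteq> b" using cd N(1) by auto
    have edges: "{a, c} \<in> H" "{a, d} \<in> H" "{b, c} \<in> H" "{b, d} \<in> H"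
      using N(2) E cd(1,2) by blast+
    then have edges': "{c, a} \<in> H" "{d, a} \<in> H" "{c, b} \<in> H" "{d, b} \<in> H"
      by (simp_all add: insert_commute)
    have ne: "r u \<noteq> r v" if "u \<in> V" "v \<in> V" "u \<noteq> v" for u v
      using perfect that by (auto simp: perfect_ranking_def inj_on_def)
    \<comment> \<open>Otherwise \<open>c\<close> and \<open>d\<close> would be later neighbours of
      one vertex, hence adjacent.\<close>
    have notfirst: "\<not> (r a < r c \<and> r a < r d)" "\<not> (r b < r c \<and> r b < r d)"
      using perfect_rankingD[OF perfect, of a c d] perfect_rankingD[OF perfect, of b c d] cd V ab edges
      by auto
    \<comment> \<open>The earlier of \<open>c\<close> and \<open>d\<close> precedes both
      \<open>a\<close> and \<open>b\<close>, which are therefore later neighbours of it.\<close>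
    have adj: "{a, b} \<in> H"
    proof (cases "r c < r d")
      case True
      then have "r c < r a" "r c < r b"
        using notfirst ne[of c a] ne[of c b] V ab by auto
      then show ?thesis using perfect_rankingD[OF perfect, of c a b] V ab edges' by simp
    next
      case False
      then have "r d < r a" "r d < r b"
        using notfirst ne[of d a] ne[of d b] ne[of c d] cd V ab by auto
      then show ?thesis using perfect_rankingD[OF perfect, of d a b] V ab edges' by simp
    qed
    \<comment> \<open>Here \<open>x\<close> is the twin that is kept and \<open>y\<close> the one
      that is replaced.\<close>
    have copy: "\<exists>H' r'. E \<subseteq> H' \<and> finite H' \<and> card H' \<le> card H \<and> perfect_ranking V H' r' \<and>
        r' x = 2 * r x + s \<and> r' y = 2 * r x + t"
      if xy: "{x, y} = {a, b}" and deg: "card {z. {x, z} \<in> H} \<le> card {z. {y, z} \<in> H}"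
        and st: "s \<le> 1" "t \<le> 1" "s \<noteq> t" for x y s t
    proof -
      have x: "x \<in> V" "y \<in> V" "x \<noteq> y" "{x, y} \<in> H"
        using xy[symmetric] ab adj by (auto simp: doubleton_eq_iff insert_commute)
      let ?H' = "{e \<in> H. y \<notin> e} \<union> insert {x, y} ((\<lambda>z. {y, z}) ` ({z. {x, z} \<in> H} - {y}))"
      let ?r' = "\<lambda>v. if v = x then 2 * r x + s else if v = y then 2 * r x + t else 2 * r v"
      \<comment> \<open>An original edge at \<open>y\<close> ends in some \<open>z\<close> of
        \<open>N\<close>. As \<open>{x, z}\<close> is in \<open>H\<close> too, copying
        \<open>x\<close> restores it.\<close>
      have "E \<subseteq> ?H'"
      proof
        fix e assume e: "e \<in> E"
        show "e \<in> ?H'"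
        proof (cases "y \<in> e")
          case True
          then obtain z where "z \<in> N" "e = {y, z}"
            using E_cases[OF e] xy N(1) by (auto simp: doubleton_eq_iff)
          moreover have "{x, z} \<in> H" "z \<noteq> y"
            using \<open>z \<in> N\<close> N(1) N(2)[of z] E xy unfolding doubleton_eq_iff by blast+
          ultimately show ?thesis by blast
        next
          case False
          then show ?thesis using e E by blast
        qed
      qed
      moreover have "finite ?H'"
        using finH \<open>finite V\<close> simple_edgesD[OF simple] finite_subset[of "{z. {x, z} \<in> H}" V] by auto
      moreover have "?r' x = 2 * r x + s" "?r' y = 2 * r x + t"
        using x(3) by simp_all
      ultimately show ?thesis
        using copy_vertex[OF simple \<open>finite V\<close> perfect x deg st]
        by (intro exI[of _ ?H'] exI[of _ ?r'] conjI)
    qed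
    show ?thesis
    proof (cases "card {z. {a, z} \<in> H} \<le> card {z. {b, z} \<in> H}")
      case True
      then obtain H' r' where "E \<subseteq> H'" "finite H'" "card H' \<le> card H" "perfect_ranking V H' r'"
          "r' a = 2 * r a + 0" "r' b = 2 * r a + 1"
        using copy[of a b 0 1] by (auto simp: insert_commute)
      then show ?thesis by (intro exI[of _ H'] exI[of _ r']) simp
    next
      case False
      then obtain H' r' where "E \<subseteq> H'" "finite H'" "card H' \<le> card H" "perfect_ranking V H' r'"
          "r' b = 2 * r b + 1" "r' a = 2 * r b + 0"
        using copy[of b a 1 0] by (auto simp: insert_commute)
      then show ?thesis by (intro exI[of _ H'] exI[of _ r']) simp
    qed
  qed
qed

section \<open>From an optimal filled graph to an optimal ordering with consecutive twins\<close>

theorem theorem4: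
  fixes G :: "'a graph" and a b :: 'a
  assumes "finite_simple_graph G"
    and "a \<in> fst G" and "b \<in> fst G" and "a \<noteq> b"
    and "twins G a b"
  shows "\<exists>\<sigma> i. node_ordering G \<sigma> \<and> i + 2 \<le> card (fst G) \<and>
           \<sigma> (i + 1) = a \<and> \<sigma> (i + 2) = b \<and>
           (\<forall>j \<in> {1..card (fst G)} - {i + 1, i + 2}. \<sigma> j \<in> fst G - {a, b}) \<and>
           fill_in G \<sigma> = min_fill_in G"
proof -
  let ?n = "card (fst G)" and ?V = "fst G"
  have fin: "finite ?V" and simple: "simple_edges ?V (snd G)"
    using assms(1) by (auto simp: finite_simple_graph_def simple_edges_def)
  obtain \<sigma>' where "bij_betw \<sigma>' {1..?n} ?V"
    using fin by (metis ex_bij_betw_nat_finite_1)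
  then obtain \<sigma>\<^sub>0 where \<sigma>\<^sub>0: "node_ordering G \<sigma>\<^sub>0" "fill_in G \<sigma>\<^sub>0 = min_fill_in G"
    using LeastI_ex[of "\<lambda>k. \<exists>\<sigma>. node_ordering G \<sigma> \<and> fill_in G \<sigma> = k"]
    unfolding min_fill_in_def node_ordering_def by blast
  let ?H = "filled G \<sigma>\<^sub>0 ?n"
  have H: "simple_edges ?V ?H" "perfect_ranking ?V ?H (inv_into {1..?n} \<sigma>\<^sub>0)" "snd G \<subseteq> ?H"
    using snd_elim_graph[OF simple] perfect_ranking_filled[OF simple] \<sigma>\<^sub>0(1)
    by (auto simp: node_ordering_def filled_def)
  have "{a, x} \<in> snd G \<longleftrightarrow> {b, x} \<in> snd G" for x
    using assms(5) simple_edgesD(2)[OF simple] unfolding twins_def neighborhood_def by blast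
  then obtain H' r where H': "snd G \<subseteq> H'" "finite H'" "card H' \<le> card ?H"
    and r: "perfect_ranking ?V H' r" "r b = Suc (r a)"
    using ex_perfect_consecutive[OF H(1) fin H(2) assms(2-4) H(3)] by blast
  have "inj_on r ?V" using r(1) by (simp add: perfect_ranking_def)
  then obtain \<sigma> where bij: "bij_betw \<sigma> {1..?n} ?V" and mono: "strict_mono_on {1..?n} (r \<circ> \<sigma>)"
    using ex_ordering_of_ranking fin by blast
  \<comment> \<open>The filled graph of \<open>\<sigma>\<close> lies inside \<open>H'\<close>, so it
    has no more edges than the optimal one.\<close>
  have "card (filled G \<sigma> ?n) \<le> card H'"
    using filled_subset_perfect[OF simple r(1) H'(1) bij_betw_imp_surj_on[OF bij] mono] H'(2)
    by (intro card_mono) auto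
  then have "fill_in G \<sigma> \<le> min_fill_in G"
    using H'(3) card_filled_fill_in[OF simple fin] \<sigma>\<^sub>0(2) by simp
  moreover have "min_fill_in G \<le> fill_in G \<sigma>"
    unfolding min_fill_in_def using bij by (intro Least_le) (auto simp: node_ordering_def)
  ultimately have opt: "fill_in G \<sigma> = min_fill_in G" by simp
  have "a \<in> \<sigma> ` {1..?n}" "b \<in> \<sigma> ` {1..?n}"
    using assms(2,3) bij_betw_imp_surj_on[OF bij] by simp_all
  then obtain k m where k: "k \<in> {1..?n}" "\<sigma> k = a" and m: "m \<in> {1..?n}" "\<sigma> m = b"
    by (elim imageE) simp
  have less: "r (\<sigma> i) < r (\<sigma> j) \<longleftrightarrow> i < j" if "i \<in> {1..?n}" "j \<in> {1..?n}" for i j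
    using strict_mono_on_less[OF mono that] by simp
  have "k < m" using less[of k m] k m r(2) by simp
  \<comment> \<open>A position strictly between \<open>k\<close> and \<open>m\<close> would have a
    rank strictly between \<open>r a\<close> and \<open>Suc (r a)\<close>.\<close>
  moreover have "\<not> Suc k < m"
    using less[of k "Suc k"] less[of "Suc k" m] k m r(2) by auto
  ultimately have mk: "m = Suc k" by simp
  \<comment> \<open>\<open>i\<close> counts the vertices before \<open>a\<close>, whose position is
    \<open>i + 1\<close>.\<close>
  obtain i where i: "k = Suc i" using k(1) by (cases k) auto
  have "\<forall>j \<in> {1..?n} - {i + 1, i + 2}. \<sigma> j \<in> ?V - {a, b}"
  proof
    fix j assume that: "j \<in> {1..?n} - {i + 1, i + 2}"
    have "\<sigma> j \<noteq> \<sigma> k" "\<sigma> j \<noteq> \<sigma> m"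
      using that bij k(1) m(1) i mk by (auto simp: bij_betw_def inj_on_eq_iff)
    then show "\<sigma> j \<in> ?V - {a, b}" using that k(2) m(2) bij_betw_apply[OF bij, of j] by simp
  qed
  moreover have "i + 2 \<le> ?n" "\<sigma> (i + 1) = a" "\<sigma> (i + 2) = b"
    using k m i mk by simp_all
  ultimately show ?thesis
    using bij opt unfolding node_ordering_def by (intro exI[of _ \<sigma>] exI[of _ i] conjI)
qed

end
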